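(* Let $\theta\in(0,2\pi)\setminus\mathbb{Q}\pi$. Then there exists a dense subset $S_\theta\subseteq(2,\infty)$ such that for each $s\in S_\theta$, every point $\xi$ on the coordinate curve $\mathfrak{C}_\theta\cap\{z=s\}$ corresponds to a holonomy map $\rho_\xi$ that has a palindromic non-torsion-type word in its kernel.
   Context: $F_2=\langle X,Y,Z\mid XYZ=1\rangle$ is the free group on $X,Y$, identified with $\pi_1(M)$ for $M$ a once-punctured torus. For $\theta\in(0,2\pi)$, the Fricke--Klein space $\mathfrak{C}_\theta$ of marked incomplete hyperbolic structures on $M$ with a single cone point of angle $\theta$ at the puncture is identified with $$\mathfrak{C}_\theta=\{(x,y,z)\in(2,\infty)^3\mid x^2+y^2+z^2-xyz-2=-2\cos(\theta/2)\},$$ where $x,y,z$ are the absolute values of the traces of the holonomies of $X,Y,Z$. For $\xi=(x,y,z)\in\mathfrak{C}_\theta$ the holonomy map $\rho_\xi\colon F_2\to\mathrm{PSL}(2,\mathbb{R})$ is well defined up to conjugation; up to conjugation by an isometry of $\mathbb{H}^2$ it is the projection to $\mathrm{PSL}(2,\mathbb{R})$ of the representation $\tilde\rho_\xi\colon F_2\to \mathrm{SL}(2,\mathbb{R})$ given by $$\tilde\rho_\xi(X)=\begin{pmatrix}x&-1\\1&0\end{pmatrix},\quad \tilde\rho_\xi(Y)=\begin{pmatrix}0&\zeta^{-1}\\-\zeta&y\end{pmatrix},\quad \zeta\ge1,\ \zeta+\zeta^{-1}=z,$$ for which $\mathrm{tr}\,\tilde\rho_\xi(X)=x$, $\mathrm{tr}\,\tilde\rho_\xi(Y)=y$,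 $\mathrm{tr}\,\tilde\rho_\xi(Z)=z$. A word $u\in F_2$ is of torsion-type if $u\in\bigcup_{m\ge2}\bigcup_{r\in F_2\setminus\{1\}}\langle\!\langle r^m\rangle\!\rangle$, where $\langle\!\langle\cdot\rangle\!\rangle$ denotes normal closure in $F_2$; it is of non-torsion-type if it is not of torsion-type. A word $w$ is palindromic in $\{X,Y\}$ if, written as a word in $X^{\pm1},Y^{\pm1}$, it reads the same forward and backward, i.e. $w(X,Y)^{-1}=w(X^{-1},Y^{-1})$; similarly for $\{Y,Z\}$ and $\{Z,X\}$. An element of $F_2$ is palindromic if it can be expressed as a word palindromic in $\{X,Y\}$, $\{Y,Z\}$ or $\{Z,X\}$. *)

theory Defs
  imports "HOL-Analysis.Analysis" "HOL-Algebra.Coset"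
begin

section \<open>Words in a group\<close>

text \<open>A word is a list of letters; \<open>(g, True)\<close> stands for \<open>g\<close> and \<open>(g, False)\<close> for its formal
  inverse. Words need not be reduced.\<close>

type_synonym 'g word = "('g \<times> bool) list"

fun letter_val :: "('a, 'm) monoid_scheme \<Rightarrow> ('g \<Rightarrow> 'a) \<Rightarrow> 'g \<times> bool \<Rightarrow> 'a" where
  "letter_val G f (g, e) = (if e then f g else inv\<^bsub>G\<^esub> f g)"

definition word_val :: "('a, 'm) monoid_scheme \<Rightarrow> ('g \<Rightarrow> 'a) \<Rightarrow> 'g word \<Rightarrow> 'a" where
  "word_val G f u = foldr (\<lambda>l a. letter_val G f l \<otimes>\<^bsub>G\<^esub> a) u \<one>\<^bsub>G\<^esub>"

definition normal_closure :: "('a, 'm) monoid_scheme \<Rightarrow> 'a set \<Rightarrow> 'a set" where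
  "normal_closure G A = \<Inter>{N. N \<lhd> G \<and> A \<subseteq> N}"


section \<open>The free group of rank two\<close>

datatype gen = gX | gY

fun inv_letter :: "'g \<times> bool \<Rightarrow> 'g \<times> bool" where
  "inv_letter (g, e) = (g, \<not> e)"

definition reduced_word :: "'g word \<Rightarrow> bool" where
  "reduced_word u \<longleftrightarrow> successively (\<lambda>a b. b \<noteq> inv_letter a) u"

fun cons_red :: "'g \<times> bool \<Rightarrow> 'g word \<Rightarrow> 'g word" where
  "cons_red l [] = [l]"
| "cons_red l (m # u) = (if m = inv_letter l then u else l # m # u)"

text \<open>For reduced \<open>v\<close>, the word \<open>foldr cons_red u v\<close> is the reduced form of the
  concatenation \<open>u @ v\<close>.\<close>

definition F2 :: "gen word monoid" where
  "F2 = \<lparr>carrier = {u. reduced_word u}, monoid.mult = (\<lambda>u v. foldr cons_red u v), one = []\<rparr>"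

definition F2_X :: "gen word" where "F2_X = [(gX, True)]"
definition F2_Y :: "gen word" where "F2_Y = [(gY, True)]"
definition F2_Z :: "gen word" where "F2_Z = inv\<^bsub>F2\<^esub> (F2_X \<otimes>\<^bsub>F2\<^esub> F2_Y)"

text \<open>The elements of \<open>G\<close> expressible as a palindromic word in two given elements and their
  inverses; the word itself is not required to be reduced.\<close>

definition palindromic_in :: "('a, 'm) monoid_scheme \<Rightarrow> 'a \<Rightarrow> 'a \<Rightarrow> 'a set" where
  "palindromic_in G a b = {word_val G (case_gen a b) u | u. rev u = u}"

definition palindromic :: "gen word \<Rightarrow> bool" where
  "palindromic w \<longleftrightarrow>
     w \<in> palindromic_in F2 F2_X F2_Y \<or>
     w \<in> palindromic_in F2 F2_Y F2_Z \<or>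
     w \<in> palindromic_in F2 F2_Z F2_X"

definition torsion_type :: "gen word set" where
  "torsion_type =
     (\<Union>m\<in>{m::nat. m \<ge> 2}. \<Union>r\<in>carrier F2 - {\<one>\<^bsub>F2\<^esub>}. normal_closure F2 {r [^]\<^bsub>F2\<^esub> m})"

definition non_torsion_type :: "gen word \<Rightarrow> bool" where
  "non_torsion_type w \<longleftrightarrow> w \<in> carrier F2 \<and> w \<notin> torsion_type"


section \<open>Matrix groups\<close>

definition SL2R :: "(real^2^2) monoid" where
  "SL2R = \<lparr>carrier = {A. det A = 1}, monoid.mult = (**), one = mat 1\<rparr>"

definition PSL2R :: "(real^2^2) set monoid" where
  "PSL2R = SL2R Mod {mat 1, - mat 1}"

definition PSL2R_proj :: "real^2^2 \<Rightarrow> (real^2^2) set" where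
  "PSL2R_proj A = {mat 1, - mat 1} #>\<^bsub>SL2R\<^esub> A"


section \<open>Holonomy of one-cone tori\<close>

definition fricke_klein :: "real \<Rightarrow> (real \<times> real \<times> real) set" where
  "fricke_klein \<theta> = {(x, y, z). 2 < x \<and> 2 < y \<and> 2 < z \<and>
     x\<^sup>2 + y\<^sup>2 + z\<^sup>2 - x * y * z - 2 = - 2 * cos (\<theta> / 2)}"

definition zeta :: "real \<Rightarrow> real" where
  "zeta z = (THE t. t \<ge> 1 \<and> t + inverse t = z)"

fun gen_matrix :: "real \<times> real \<times> real \<Rightarrow> gen \<Rightarrow> real^2^2" where
  "gen_matrix (x, y, z) gX = vector [vector [x, -1], vector [1, 0]]"
| "gen_matrix (x, y, z) gY = vector [vector [0, inverse (zeta z)], vector [- zeta z, y]]"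

definition rho_tilde :: "real \<times> real \<times> real \<Rightarrow> gen word \<Rightarrow> real^2^2" where
  "rho_tilde \<xi> = word_val SL2R (gen_matrix \<xi>)"

text \<open>The holonomy map is only defined up to conjugation by isometries of the hyperbolic plane;
  \<open>rho \<xi>\<close> is the standard representative. Its kernel depends only on the conjugacy class.\<close>

definition rho :: "real \<times> real \<times> real \<Rightarrow> gen word \<Rightarrow> (real^2^2) set" where
  "rho \<xi> w = PSL2R_proj (rho_tilde \<xi> w)"


section \<open>Well-definedness\<close>

lemma inv_letter_inv_letter [simp]: "inv_letter (inv_letter l) = l"
  by (cases l) simp

lemma reduced_Nil [simp]: "reduced_word []"
  by (simp add: reduced_word_def)

lemma reduced_Cons_iff:
  "reduced_word (l # u) \<longleftrightarrow> reduced_word u \<and> (u = [] \<or> hd u \<noteq> inv_letter l)"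
  by (cases u) (auto simp: reduced_word_def)

lemma reduced_cons_red: "reduced_word u \<Longrightarrow> reduced_word (cons_red l u)"
  by (cases u) (auto simp: reduced_Cons_iff)

lemma cons_red_reduced: "reduced_word (l # u) \<Longrightarrow> cons_red l u = l # u"
  by (cases u) (auto simp: reduced_Cons_iff)

lemma reduced_foldr: "reduced_word v \<Longrightarrow> reduced_word (foldr cons_red u v)"
  by (induction u) (auto simp: reduced_cons_red)

lemma cons_red_inv_letter: "reduced_word u \<Longrightarrow> cons_red l (cons_red (inv_letter l) u) = u"
  by (cases u) (auto simp: reduced_Cons_iff cons_red_reduced)

lemma foldr_cons_red_Nil: "reduced_word u \<Longrightarrow> foldr cons_red u [] = u"
  by (induction u) (auto simp: reduced_Cons_iff cons_red_reduced)

lemma foldr_cons_red_cons_red: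
  "reduced_word v \<Longrightarrow> foldr cons_red (cons_red l u) v = cons_red l (foldr cons_red u v)"
  by (cases u) (auto simp: cons_red_inv_letter reduced_foldr)

lemma foldr_cons_red_assoc:
  "reduced_word w \<Longrightarrow> foldr cons_red (foldr cons_red u v) w = foldr cons_red u (foldr cons_red v w)"
  by (induction u) (auto simp: foldr_cons_red_cons_red)

lemma foldr_cons_red_inverse:
  "reduced_word v \<Longrightarrow> foldr cons_red (map inv_letter (rev u)) (foldr cons_red u v) = v"
proof (induction u arbitrary: v)
  case (Cons l u)
  then show ?case
    using cons_red_inv_letter[of "foldr cons_red u v" "inv_letter l"] by (simp add: reduced_foldr)
qed simp

lemma group_F2: "group F2"
proof (rule groupI)
  fix u assume "u \<in> carrier F2"
  then have u: "reduced_word u" by (simp add: F2_def)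
  have "foldr cons_red (foldr cons_red (map inv_letter (rev u)) []) u = []"
    using foldr_cons_red_inverse[of "[]" u] u
    by (simp add: foldr_cons_red_assoc foldr_cons_red_Nil)
  then show "\<exists>v\<in>carrier F2. v \<otimes>\<^bsub>F2\<^esub> u = \<one>\<^bsub>F2\<^esub>"
    by (intro bexI[of _ "foldr cons_red (map inv_letter (rev u)) []"])
      (simp_all add: F2_def reduced_foldr)
qed (auto simp: F2_def reduced_foldr foldr_cons_red_assoc)

lemma F2_X_closed: "F2_X \<in> carrier F2" and F2_Y_closed: "F2_Y \<in> carrier F2"
  by (simp_all add: F2_X_def F2_Y_def F2_def reduced_word_def)

lemma F2_XYZ: "F2_X \<otimes>\<^bsub>F2\<^esub> F2_Y \<otimes>\<^bsub>F2\<^esub> F2_Z = \<one>\<^bsub>F2\<^esub>"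
  unfolding F2_Z_def by (simp add: group.r_inv group_F2 F2_X_closed F2_Y_closed monoid.m_closed group.is_monoid)

text \<open>The universal property of the free group.\<close>

lemma word_val_hom:
  assumes "group G" and f: "\<And>g. f g \<in> carrier G"
  shows "word_val G f \<in> hom F2 G"
proof -
  interpret group G by fact
  have l: "letter_val G f a \<in> carrier G" for a
    by (cases a) (simp add: f)
  have li: "letter_val G f a \<otimes>\<^bsub>G\<^esub> (letter_val G f (inv_letter a) \<otimes>\<^bsub>G\<^esub> c) = c"
    if "c \<in> carrier G" for a c
    using that f by (cases a) (simp add: m_assoc[symmetric])
  have w: "word_val G f u \<in> carrier G" for u
    by (induction u) (simp_all add: word_val_def l)
  have c: "word_val G f (cons_red a u) = letter_val G f a \<otimes>\<^bsub>G\<^esub> word_val G f u" for a u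
  proof (cases u)
    case (Cons m v)
    then show ?thesis using li[OF w, of a v] by (simp add: word_val_def)
  qed (simp add: word_val_def)
  have "word_val G f (foldr cons_red u v) = word_val G f u \<otimes>\<^bsub>G\<^esub> word_val G f v" for u v
  proof (induction u)
    case Nil
    show ?case using w[of v] by (simp add: word_val_def[of G f "[]"])
  next
    case (Cons a u)
    have "word_val G f (a # u) = letter_val G f a \<otimes>\<^bsub>G\<^esub> word_val G f u"
      by (simp add: word_val_def)
    then show ?case by (simp add: c Cons.IH m_assoc l w)
  qed
  then show ?thesis by (auto simp: hom_def F2_def w)
qed

lemma word_val_X:
  assumes "group G" and "\<And>g. f g \<in> carrier G"
  shows "word_val G f F2_X = f gX"
proof -
  interpret group G by fact
  show ?thesis using assms(2) by (simp add: word_val_def F2_X_def)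
qed

lemma word_val_Y:
  assumes "group G" and "\<And>g. f g \<in> carrier G"
  shows "word_val G f F2_Y = f gY"
proof -
  interpret group G by fact
  show ?thesis using assms(2) by (simp add: word_val_def F2_Y_def)
qed

lemma group_SL2R: "group SL2R"
proof (rule groupI)
  fix A :: "real^2^2" assume "A \<in> carrier SL2R"
  then have A: "det A = 1" by (simp add: SL2R_def)
  then obtain B where B: "B ** A = mat 1"
    using invertible_det_nz[of A] invertible_left_inverse[of A] by auto
  then have "det B = 1"
    using A by (metis det_I det_mul mult.right_neutral)
  then show "\<exists>B\<in>carrier SL2R. B \<otimes>\<^bsub>SL2R\<^esub> A = \<one>\<^bsub>SL2R\<^esub>"
    using B by (auto simp: SL2R_def)
qed (auto simp: SL2R_def det_mul matrix_mul_assoc)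

lemma normal_center_SL2R: "{mat 1, - mat 1} \<lhd> SL2R"
proof -
  interpret group SL2R by (rule group_SL2R)
  have neg: "- mat 1 \<in> carrier SL2R"
    by (simp add: SL2R_def det_2 mat_def)
  have mul: "- A ** B = - (A ** B)" "A ** (- B) = - (A ** B)" for A B :: "real^2^2"
    by (simp_all add: matrix_matrix_mult_def vec_eq_iff sum_negf)
  have inv_neg: "inv\<^bsub>SL2R\<^esub> (- mat 1) = - mat 1"
    by (rule inv_equality) (use neg in \<open>simp_all add: SL2R_def mul\<close>)
  have one: "inv\<^bsub>SL2R\<^esub> (mat 1) = mat 1"
    using inv_one by (simp add: SL2R_def)
  have sub: "subgroup {mat 1, - mat 1} SL2R"
  proof (rule subgroupI)
    show "{mat 1, - mat 1} \<subseteq> carrier SL2R"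
      using neg one_closed by (auto simp: SL2R_def)
    fix a b :: "real^2^2"
    assume a: "a \<in> {mat 1, - mat 1}"
    then show "inv\<^bsub>SL2R\<^esub> a \<in> {mat 1, - mat 1}"
      using inv_neg one by auto
    assume "b \<in> {mat 1, - mat 1}"
    with a show "a \<otimes>\<^bsub>SL2R\<^esub> b \<in> {mat 1, - mat 1}"
      by (auto simp: SL2R_def mul)
  qed simp
  show ?thesis
  proof (rule normal_invI[OF sub])
    fix A h assume A: "A \<in> carrier SL2R" and h: "h \<in> {mat 1, - mat 1 :: real^2^2}"
    have "A \<otimes>\<^bsub>SL2R\<^esub> h = h \<otimes>\<^bsub>SL2R\<^esub> A"
      using h by (auto simp: SL2R_def mul)
    then have "A \<otimes>\<^bsub>SL2R\<^esub> h \<otimes>\<^bsub>SL2R\<^esub> inv\<^bsub>SL2R\<^esub> A = h"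
      using A h subgroup.mem_carrier[OF sub h] by (simp add: m_assoc)
    then show "A \<otimes>\<^bsub>SL2R\<^esub> h \<otimes>\<^bsub>SL2R\<^esub> inv\<^bsub>SL2R\<^esub> A \<in> {mat 1, - mat 1}"
      using h by simp
  qed
qed

lemma zeta_eqI:
  assumes "t \<ge> 1" and "t + inverse t = z"
  shows "zeta z = t"
  unfolding zeta_def
proof (rule the_equality)
  show "t \<ge> 1 \<and> t + inverse t = z" using assms by simp
  fix s assume s: "s \<ge> 1 \<and> s + inverse s = z"
  have "s * t * (s + inverse s) = s * t * (t + inverse t)" using s assms by simp
  moreover have "s * inverse s = 1" "t * inverse t = 1" using s assms by simp_all
  ultimately have "(s - t) * (s * t - 1) = 0" by algebra
  then show "s = t"
  proof (simp, elim disjE)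
    assume st: "s * t = 1"
    have "s \<le> s * t" "t \<le> s * t" using s assms by (simp_all add: mult_le_cancel_left1 mult_le_cancel_right1)
    with st s assms show "s = t" by simp
  qed
qed

lemma zeta:
  assumes "z \<ge> 2"
  shows "zeta z \<ge> 1" and "zeta z + inverse (zeta z) = z"
proof -
  define r where "r = sqrt (z\<^sup>2 - 4)"
  have "2\<^sup>2 \<le> z\<^sup>2" using assms by (intro power_mono) auto
  then have r: "r \<ge> 0" "r\<^sup>2 = z\<^sup>2 - 4" by (simp_all add: r_def)
  define t where "t = (z + r) / 2"
  have t1: "t \<ge> 1" using assms r by (simp add: t_def)
  have "t * ((z - r) / 2) = 1"
    using r by (simp add: t_def power2_eq_square field_simps)
  then have "inverse t = (z - r) / 2" by (rule inverse_unique)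
  then have "t + inverse t = z" by (simp add: t_def field_simps)
  with t1 have "zeta z = t" by (rule zeta_eqI)
  with t1 \<open>t + inverse t = z\<close> show "zeta z \<ge> 1" "zeta z + inverse (zeta z) = z" by simp_all
qed

lemma gen_matrix_closed:
  assumes "z \<ge> 2"
  shows "gen_matrix (x, y, z) g \<in> carrier SL2R"
  using zeta(1)[OF assms] by (cases g) (simp_all add: SL2R_def det_2)

lemma rho_tilde_hom:
  assumes "z \<ge> 2"
  shows "rho_tilde (x, y, z) \<in> hom F2 SL2R"
  unfolding rho_tilde_def
  by (rule word_val_hom[OF group_SL2R gen_matrix_closed[OF assms]])

lemma rho_hom:
  assumes "z \<ge> 2"
  shows "rho (x, y, z) \<in> hom F2 PSL2R"
proof -
  have "PSL2R_proj \<in> hom SL2R PSL2R"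
    using normal.r_coset_hom_Mod[OF normal_center_SL2R]
    unfolding PSL2R_def PSL2R_proj_def[abs_def] .
  from Group.hom_compose[OF rho_tilde_hom[OF assms] this, of x y]
  show ?thesis by (simp add: rho_def[abs_def] comp_def)
qed

end

theory Submission
  imports Defs
begin

text \<open>Put \<open>a = XY\<close> and \<open>b = YX\<close>; their subgroup is the fundamental group of the torus cut along \<open>Z\<close>,
  so its image depends, up to conjugation, only on \<open>\<theta>\<close> and \<open>z\<close>. Reversal of words exchanges \<open>a\<close> and \<open>b\<close>,
  and in the image it is \<open>v \<mapsto> J v\<^sup>-\<^sup>1 J\<^sup>-\<^sup>1\<close>, where \<open>J = a - b\<close> is, up to scaling, a rotation
  by \<open>\<pi>\<close>. Hence the palindrome \<open>v v\<^sup>*\<close>, with \<open>v\<^sup>*\<close> the reversal of \<open>v\<close>, is in the kernel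
  as soon as \<open>v\<close> commutes with \<open>J\<close>. With \<open>c = b\<^sup>-\<^sup>1 a\<close> and \<open>c' = a b\<^sup>-\<^sup>1\<close> take
  \<open>v = c'\<^sup>-\<^sup>1 c\<^sup>m b\<^sup>-\<^sup>1 c\<^sup>-\<^sup>1\<close>. The reflection symmetry that exchanges \<open>a\<close> and \<open>b\<close> makes
  commuting with \<open>J\<close> a single equation, of the form \<open>cot (m \<phi>) = F z\<close>, where \<open>\<phi> = \<pi> - \<theta> / 2\<close> is the
  angle of the rotation \<open>c\<close> and \<open>F\<close> is injective. As \<open>\<phi> / \<pi>\<close> is irrational, the values of \<open>cot (m \<phi>)\<close>
  are dense, so solutions \<open>z\<close> are dense. The word is of non-torsion type because \<open>v\<close> has exponent sums
  \<open>(-1, -1)\<close>.\<close>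

section \<open>Evaluation of words through the free group\<close>

lemma (in group) letter_val_closed:
  assumes "\<And>g. f g \<in> carrier G"
  shows "letter_val G f l \<in> carrier G"
  using assms by (cases l) simp

lemma word_val_Nil [simp]: "word_val G f [] = \<one>\<^bsub>G\<^esub>"
  by (simp add: word_val_def)

lemma word_val_Cons: "word_val G f (l # u) = letter_val G f l \<otimes>\<^bsub>G\<^esub> word_val G f u"
  by (simp add: word_val_def)

lemma (in group) word_val_closed:
  assumes "\<And>g. f g \<in> carrier G"
  shows "word_val G f u \<in> carrier G"
  by (induction u) (simp_all add: word_val_Cons letter_val_closed assms)

lemma (in group) word_val_append:
  assumes "\<And>g. f g \<in> carrier G"
  shows "word_val G f (u @ v) = word_val G f u \<otimes> word_val G f v"
  by (induction u) (simp_all add: word_val_Cons letter_val_closed word_val_closed m_assoc assms)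

lemma case_gen_closed: "case_gen F2_X F2_Y g \<in> carrier F2"
  by (cases g) (simp_all add: F2_X_closed F2_Y_closed)

lemma word_val_F2_closed: "word_val F2 (case_gen F2_X F2_Y) u \<in> carrier F2"
  by (rule group.word_val_closed[OF group_F2 case_gen_closed])

text \<open>Evaluation is a homomorphism on \<open>F2\<close> that agrees with \<open>f\<close> on
  the generators, so free reduction does not change the value. Images can therefore be computed from
  the unreduced spelling.\<close>

lemma (in group) word_val_word_val_F2:
  assumes f: "\<And>g. f g \<in> carrier G"
  shows "word_val G f (word_val F2 (case_gen F2_X F2_Y) u) = word_val G f u"
proof -
  have hom: "word_val G f \<in> hom F2 G"
    by (rule word_val_hom[OF is_group f])
  interpret h: group_hom F2 G "word_val G f"
    by (simp add: group_hom.intro group_F2 is_group group_hom_axioms.intro hom)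
  have g: "word_val G f (case_gen F2_X F2_Y g) = f g" for g
    by (cases g) (simp_all add: word_val_X word_val_Y is_group f)
  have "word_val G f (letter_val F2 (case_gen F2_X F2_Y) l) = letter_val G f l" for l
    by (cases l) (simp add: case_gen_closed h.hom_inv g)
  then show ?thesis
    by (induction u)
      (simp_all add: word_val_Cons h.hom_mult group.letter_val_closed[OF group_F2 case_gen_closed]
        word_val_F2_closed del: letter_val.simps)
qed

lemma palindromic_append_rev: "palindromic (word_val F2 (case_gen F2_X F2_Y) (v @ rev v))"
  unfolding palindromic_def palindromic_in_def by (rule disjI1) force

section \<open>Non-torsion type, tested in a Heisenberg group\<close>

text \<open>The integer Heisenberg group with its last coordinate reduced modulo 2:
  \<open>\<noteq>\<close> on booleans is addition modulo 2, and \<open>odd a \<and> odd b'\<close>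
  is the cocycle \<open>a * b'\<close>.\<close>

definition heis2 :: "(int \<times> int \<times> bool) monoid" where
  "heis2 = \<lparr>carrier = UNIV,
     monoid.mult = (\<lambda>(a, b, c) (a', b', c'). (a + a', b + b', c \<noteq> (c' \<noteq> (odd a \<and> odd b')))),
     one = (0, 0, False)\<rparr>"

fun heis2_gen :: "gen \<Rightarrow> int \<times> int \<times> bool" where
  "heis2_gen gX = (1, 0, False)"
| "heis2_gen gY = (0, 1, False)"

lemma carrier_heis2 [simp]: "x \<in> carrier heis2"
  by (simp add: heis2_def)

lemma heis2_mult [simp]:
  "(a, b, c) \<otimes>\<^bsub>heis2\<^esub> (a', b', c') = (a + a', b + b', c \<noteq> (c' \<noteq> (odd a \<and> odd b')))"
  by (simp add: heis2_def)

lemma heis2_one [simp]: "\<one>\<^bsub>heis2\<^esub> = (0, 0, False)"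
  by (simp add: heis2_def)

lemma group_heis2: "group heis2"
proof (rule groupI)
  fix x assume "x \<in> carrier heis2"
  obtain a b c where "x = (a, b, c)" by (metis prod_cases3)
  then show "\<exists>y\<in>carrier heis2. y \<otimes>\<^bsub>heis2\<^esub> x = \<one>\<^bsub>heis2\<^esub>"
    by (intro bexI[of _ "(- a, - b, c \<noteq> (odd a \<and> odd b))"]) auto
qed (auto simp: split_paired_all)

lemma heis2_inv [simp]: "inv\<^bsub>heis2\<^esub> (a, b, c) = (- a, - b, c \<noteq> (odd a \<and> odd b))"
  by (rule group.inv_equality[OF group_heis2]) auto

lemma heis2_fst_pow: "fst (x [^]\<^bsub>heis2\<^esub> (n::nat)) = int n * fst x"
proof (induction n)
  case (Suc n)
  then show ?case
    by (cases x; cases "x [^]\<^bsub>heis2\<^esub> n") (auto simp: nat_pow_def algebra_simps)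
qed (simp add: nat_pow_def)

lemma normal_closure_subset:
  assumes "N \<lhd> G" and "A \<subseteq> N"
  shows "normal_closure G A \<subseteq> N"
  using assms by (auto simp: normal_closure_def)

lemma (in group_hom) normal_vimage:
  assumes "N \<lhd> H"
  shows "{x \<in> carrier G. h x \<in> N} \<lhd> G"
proof (rule G.normal_invI)
  interpret N: normal N H by fact
  show "subgroup {x \<in> carrier G. h x \<in> N} G"
    by (rule G.subgroupI) (auto intro!: exI[of _ "\<one>"])
  show "x \<otimes> y \<otimes> inv x \<in> {x \<in> carrier G. h x \<in> N}"
    if "x \<in> carrier G" "y \<in> {x \<in> carrier G. h x \<in> N}" for x y
    using that by (auto simp: N.inv_op_closed2)
qed

lemma heis2_word_hom: "group_hom F2 heis2 (word_val heis2 heis2_gen)"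
  by (simp add: group_hom.intro group_F2 group_heis2 group_hom_axioms.intro word_val_hom)

text \<open>The anti-automorphism that fixes both generators; it therefore describes the reversal of
  words.\<close>

definition heis2_rev :: "int \<times> int \<times> bool \<Rightarrow> int \<times> int \<times> bool" where
  "heis2_rev = (\<lambda>(a, b, c). (a, b, c \<noteq> (odd a \<and> odd b)))"

lemma word_val_heis2_rev: "word_val heis2 heis2_gen (rev u) = heis2_rev (word_val heis2 heis2_gen u)"
proof (induction u)
  case (Cons l u)
  have "heis2_rev (letter_val heis2 heis2_gen l) = letter_val heis2 heis2_gen l"
    by (cases l; cases "fst l") (auto simp: heis2_rev_def)
  moreover have "heis2_rev (x \<otimes>\<^bsub>heis2\<^esub> y) = heis2_rev y \<otimes>\<^bsub>heis2\<^esub> heis2_rev x" for x y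
    by (cases x; cases y) (auto simp: heis2_rev_def)
  ultimately show ?case
    using Cons.IH
    by (simp add: word_val_Cons group.word_val_append[OF group_heis2] monoid.r_one[OF group.is_monoid[OF group_heis2]] del: heis2_one)
qed (simp add: heis2_rev_def)

text \<open>Serves odd exponents: an \<open>m\<close>-th power has its first coordinate divisible by
  \<open>m\<close>.\<close>

lemma normal_heis2_fst_dvd: "{x. k dvd fst x} \<lhd> heis2"
proof (rule group.normal_invI[OF group_heis2])
  show "subgroup {x. k dvd fst x} heis2"
    by (rule group.subgroupI[OF group_heis2]) (auto intro!: exI[of _ "(0, 0, False)"])
qed (auto simp: split_paired_all)

text \<open>This is the cyclic group generated by the square of \<open>(p, q, d)\<close>, for either
  bit \<open>d\<close>. It is central because its first two coordinates are even.\<close>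

lemma normal_heis2_squares:
  "{(2 * p * n, 2 * q * n, odd (p * q * n)) | n. True} \<lhd> heis2" (is "?K \<lhd> _")
proof (rule group.normal_invI[OF group_heis2])
  show "subgroup ?K heis2"
  proof (rule group.subgroupI[OF group_heis2])
    fix x y assume "x \<in> ?K"
    then obtain n where n: "x = (2 * p * n, 2 * q * n, odd (p * q * n))" by auto
    then show "inv\<^bsub>heis2\<^esub> x \<in> ?K"
      by (auto intro!: exI[of _ "- n"])
    assume "y \<in> ?K"
    then obtain n' where "y = (2 * p * n', 2 * q * n', odd (p * q * n'))" by auto
    with n show "x \<otimes>\<^bsub>heis2\<^esub> y \<in> ?K"
      by (auto intro!: exI[of _ "n + n'"] simp: algebra_simps)
  qed auto
  show "x \<otimes>\<^bsub>heis2\<^esub> y \<otimes>\<^bsub>heis2\<^esub> inv\<^bsub>heis2\<^esub> x \<in> ?K" if y: "y \<in> ?K" for x y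
  proof -
    have "x \<otimes>\<^bsub>heis2\<^esub> y \<otimes>\<^bsub>heis2\<^esub> inv\<^bsub>heis2\<^esub> x = y"
      using y by (cases x) auto
    with y show ?thesis by simp
  qed
qed

text \<open>Modulo an odd \<open>m\<close> the exponent sum detects the word. For even \<open>m\<close> the relator is a square;
  squares are central in the Heisenberg group with centre reduced modulo 2, and there \<open>v\<close> times its
  reversal differs by the generator of the centre from every square with the same exponent sums.\<close>

lemma non_torsion_type_append_rev:
  assumes v: "word_val heis2 heis2_gen v = (e, e, c)" and e: "\<bar>e\<bar> = 1"
  shows "non_torsion_type (word_val F2 (case_gen F2_X F2_Y) (v @ rev v))"
proof -
  let ?h = "word_val heis2 heis2_gen" and ?w = "word_val F2 (case_gen F2_X F2_Y) (v @ rev v)"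
  interpret h: group_hom F2 heis2 ?h by (rule heis2_word_hom)
  have "odd e" using e by (auto simp: abs_if split: if_splits)
  \<comment> \<open>As \<open>e\<close> is odd, the bits of \<open>v\<close> and of its reversal
    differ, and the cocycle of their product adds 1; the total is even.\<close>
  then have w: "?h ?w = (2 * e, 2 * e, False)"
    by (simp add: group.word_val_word_val_F2[OF group_heis2] group.word_val_append[OF group_heis2]
        word_val_heis2_rev v heis2_rev_def)
  have "?w \<notin> normal_closure F2 {r [^]\<^bsub>F2\<^esub> m}" if m: "m \<ge> 2" and r: "r \<in> carrier F2" for m :: nat and r
  proof
    assume *: "?w \<in> normal_closure F2 {r [^]\<^bsub>F2\<^esub> m}"
    have K: "?h ?w \<in> K" if "K \<lhd> heis2" "?h (r [^]\<^bsub>F2\<^esub> m) \<in> K" for K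
      using normal_closure_subset[OF h.normal_vimage[OF that(1)], of "{r [^]\<^bsub>F2\<^esub> m}"] * that(2) r
      by auto
    have hr: "?h (r [^]\<^bsub>F2\<^esub> m) = ?h r [^]\<^bsub>heis2\<^esub> m"
      using r by (simp add: h.hom_nat_pow)
    show False
    proof (cases "even m")
      case False
      have "int m dvd 2 * e"
        using K[OF normal_heis2_fst_dvd[of "int m"]] w by (simp add: hr heis2_fst_pow)
      then have "int m dvd 2"
        using e by (auto simp: abs_if split: if_splits)
      then have "m dvd 2" by presburger
      with m False show False by (auto dest: dvd_imp_le)
    next
      case True
      then obtain j where j: "m = j * 2" by (metis dvdE mult.commute)
      obtain p q d where g: "?h r [^]\<^bsub>heis2\<^esub> j = (p, q, d)" by (metis prod_cases3)
      have "?h r [^]\<^bsub>heis2\<^esub> m = (?h r [^]\<^bsub>heis2\<^esub> j) [^]\<^bsub>heis2\<^esub> (2::nat)"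
        unfolding j by (rule monoid.nat_pow_pow[symmetric]) (simp_all add: group.is_monoid group_heis2)
      also have "\<dots> = (2 * p, 2 * q, odd (p * q))"
        unfolding g by (auto simp: nat_pow_def numeral_2_eq_2)
      finally have "?h (r [^]\<^bsub>F2\<^esub> m) \<in> {(2 * p * n, 2 * q * n, odd (p * q * n)) | n. True}"
        by (auto simp: hr intro!: exI[of _ 1])
      then have "(2 * e, 2 * e, False) \<in> {(2 * p * n, 2 * q * n, odd (p * q * n)) | n. True}"
        using K[OF normal_heis2_squares] w by simp
      then obtain n where n2: "2 * e = 2 * p * n" "2 * e = 2 * q * n" and ev: "False = odd (p * q * n)"
        unfolding mem_Collect_eq prod.inject by blast
      from n2 have n: "p * n = e" "q * n = e" by linarith+
      then have "odd p" "odd q" "odd n" using n \<open>odd e\<close> by auto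
      with ev show False by simp
    qed
  qed
  then show ?thesis
    by (auto simp: non_torsion_type_def torsion_type_def word_val_F2_closed)
qed

section \<open>Two-by-two real matrices\<close>

abbreviation mat2 :: "real \<Rightarrow> real \<Rightarrow> real \<Rightarrow> real \<Rightarrow> real^2^2" where
  "mat2 p q r s \<equiv> vector [vector [p, q], vector [r, s]]"

lemma SL2R_mult [simp]: "A \<otimes>\<^bsub>SL2R\<^esub> B = A ** B"
  and SL2R_one [simp]: "\<one>\<^bsub>SL2R\<^esub> = mat 1"
  by (simp_all add: SL2R_def)

lemma mat2_eq_iff: "mat2 p q r s = mat2 p' q' r' s' \<longleftrightarrow> p = p' \<and> q = q' \<and> r = r' \<and> s = s'"
  by (auto simp: vec_eq_iff forall_2)

lemma mat2_mult:
  "mat2 p q r s ** mat2 p' q' r' s' =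
     mat2 (p * p' + q * r') (p * q' + q * s') (r * p' + s * r') (r * q' + s * s')"
  by (simp add: vec_eq_iff forall_2 matrix_matrix_mult_def sum_2)

lemma mat2_diff: "mat2 p q r s - mat2 p' q' r' s' = mat2 (p - p') (q - q') (r - r') (s - s')"
  by (simp add: vec_eq_iff forall_2)

lemma mat2_scaleR: "k *\<^sub>R mat2 p q r s = mat2 (k * p) (k * q) (k * r) (k * s)"
  by (simp add: vec_eq_iff forall_2)

lemma mat2_one: "mat 1 = mat2 1 0 0 1"
  by (simp add: vec_eq_iff forall_2 mat_def)

lemma matrix_scaleR_right: "A ** (k *\<^sub>R B) = k *\<^sub>R (A ** B)" for A :: "real^'n^'m"
  by (simp add: matrix_scalar_ac scalar_matrix_assoc)

lemma matrix_scaleR_left: "(k *\<^sub>R A) ** B = k *\<^sub>R (A ** B)" for A :: "real^'n^'m"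
  by (simp add: scalar_matrix_assoc)

lemma matrix_diff_ldistrib: "A ** (B - C) = A ** B - A ** C" for A :: "'a::ring_1^'n^'m"
  by (simp add: matrix_matrix_mult_def vec_eq_iff right_diff_distrib sum_subtractf)

lemma matrix_diff_rdistrib: "(A - B) ** C = A ** C - B ** C" for A :: "'a::ring_1^'n^'m"
  by (simp add: matrix_matrix_mult_def vec_eq_iff left_diff_distrib sum_subtractf)

lemma inv_SL2R_mat2:
  assumes "p * s - q * r = 1"
  shows "inv\<^bsub>SL2R\<^esub> (mat2 p q r s) = mat2 s (- q) (- r) p"
proof (rule group.inv_equality[OF group_SL2R])
  show "mat2 s (- q) (- r) p \<otimes>\<^bsub>SL2R\<^esub> mat2 p q r s = \<one>\<^bsub>SL2R\<^esub>"
    using assms by (simp add: SL2R_def mat2_mult mat2_one mat2_eq_iff algebra_simps)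
qed (use assms in \<open>simp_all add: SL2R_def det_2 algebra_simps\<close>)

text \<open>Here \<open>a'\<close> and \<open>b'\<close> are the inverses of \<open>a\<close> and
  \<open>b\<close>, and \<open>k\<close> is the trace of \<open>c = b' ** a\<close>. The long
  products are the images of \<open>v\<close> for \<open>m = 1\<close> and \<open>m = 0\<close>.
  Their commutators with \<open>a - b\<close> are multiples of one matrix, which turns commuting
  into a scalar equation.\<close>

lemma commutator_identity:
  fixes t t' \<beta> \<gamma> z k :: real
  assumes t: "t * t' = 1" and z: "z = t + t'" and k: "k = z\<^sup>2 - 2 - \<beta> * \<gamma>"
  defines "a \<equiv> mat2 t \<beta> 0 t'" and "a' \<equiv> mat2 t' (- \<beta>) 0 t"
    and "b \<equiv> mat2 t' 0 \<gamma> t" and "b' \<equiv> mat2 t 0 (- \<gamma>) t'"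
  shows "b ** a' ** (b' ** a) ** b' ** (a' ** b) ** (a - b) - (a - b) ** (b ** a' ** (b' ** a) ** b' ** (a' ** b))
    = (z\<^sup>2 * (2 - k) * (k - 1) + (k ^ 3 - k\<^sup>2 - 2 * k + 1)) *\<^sub>R (a ** b - b ** a)" (is ?P)
   and "b ** a' ** b' ** (a' ** b) ** (a - b) - (a - b) ** (b ** a' ** b' ** (a' ** b))
    = (z\<^sup>2 * (2 - k) + (k\<^sup>2 - k - 1)) *\<^sub>R (a ** b - b ** a)" (is ?Q)
proof -
  show ?Q
    unfolding a_def a'_def b_def b'_def mat2_mult mat2_diff mat2_scaleR mat2_eq_iff k z
    using t by (intro conjI; algebra)
  show ?P
    unfolding a_def a'_def b_def b'_def mat2_mult mat2_diff mat2_scaleR mat2_eq_iff k z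
    using t by (intro conjI; algebra)
qed

section \<open>The palindrome and its image under the holonomy\<close>

text \<open>This spells \<open>v\<close>: the first block is the inverse of \<open>c'\<close>, the
  repeated block is \<open>c\<close>, and the last one is the inverse of \<open>b\<close> followed
  by the inverse of \<open>c\<close>.\<close>

definition kernel_half :: "nat \<Rightarrow> gen word" where
  "kernel_half m =
     [(gY, True), (gX, True), (gY, False), (gX, False)]
     @ concat (replicate m [(gX, False), (gY, False), (gX, True), (gY, True)])
     @ [(gX, False), (gY, False), (gY, False), (gX, False), (gY, True), (gX, True)]"

text \<open>The commutator \<open>c\<close> goes to the central element \<open>(0, 0, True)\<close>
  of order two.\<close>

lemma word_val_heis2_commutator_power:
  "word_val heis2 heis2_gen (concat (replicate m [(gX, False), (gY, False), (gX, True), (gY, True)]))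
     = (0, 0, odd m)"
  by (induction m) (simp_all add: word_val_Cons)

lemma non_torsion_type_kernel_half:
  "non_torsion_type (word_val F2 (case_gen F2_X F2_Y) (kernel_half m @ rev (kernel_half m)))"
proof (rule non_torsion_type_append_rev)
  show "word_val heis2 heis2_gen (kernel_half m) = (- 1, - 1, even m)"
    by (simp add: kernel_half_def word_val_Cons group.word_val_append[OF group_heis2]
        word_val_heis2_commutator_power)
qed simp

text \<open>Conjugation by \<open>J\<close> inverts every letter, so it realises the hyperelliptic involution.\<close>

lemma word_val_rev_hyperelliptic:
  assumes f: "\<And>g. f g \<in> carrier SL2R"
    and J: "\<And>l. letter_val SL2R f l ** J ** letter_val SL2R f l = J"
  shows "word_val SL2R f u ** J ** word_val SL2R f (rev u) = J"
proof (induction u)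
  case (Cons l u)
  let ?x = "letter_val SL2R f l" and ?u = "word_val SL2R f u" and ?r = "word_val SL2R f (rev u)"
  have "word_val SL2R f (rev (l # u)) = ?r ** ?x"
    using group.word_val_append[OF group_SL2R, of f, OF f] by (simp add: word_val_Cons)
  then have "word_val SL2R f (l # u) ** J ** word_val SL2R f (rev (l # u)) = ?x ** (?u ** J ** ?r) ** ?x"
    by (simp add: word_val_Cons matrix_mul_assoc)
  then show ?case by (simp add: Cons.IH J)
qed simp

text \<open>Chebyshev recursion for a matrix of determinant 1 and trace
  \<open>2 * cos \<phi>\<close>. The factor \<open>sin \<phi>\<close> avoids a division, and
  subtracting 1 in the reals lets the formula start at \<open>m = 0\<close>.\<close>

lemma cayley_hamilton_power:
  fixes C :: "real^2^2" and \<phi> :: real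
  assumes C: "C ** C = (2 * cos \<phi>) *\<^sub>R C - mat 1" and f: "\<And>g. f g \<in> carrier SL2R"
    and w: "word_val SL2R f w = C"
  shows "sin \<phi> *\<^sub>R word_val SL2R f (concat (replicate m w)) =
    sin (real m * \<phi>) *\<^sub>R C - sin ((real m - 1) * \<phi>) *\<^sub>R mat 1"
proof (induction m)
  case 0
  show ?case by simp
next
  case (Suc m)
  let ?V = "word_val SL2R f (concat (replicate m w))"
  have "word_val SL2R f (concat (replicate (Suc m) w)) = C ** ?V"
    using group.word_val_append[OF group_SL2R, of f, OF f] w by simp
  then have "sin \<phi> *\<^sub>R word_val SL2R f (concat (replicate (Suc m) w)) = C ** (sin \<phi> *\<^sub>R ?V)"
    by (simp add: matrix_scaleR_right)
  also have "\<dots> = sin (real m * \<phi>) *\<^sub>R (C ** C) - sin ((real m - 1) * \<phi>) *\<^sub>R C"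
    unfolding Suc.IH by (simp add: matrix_diff_ldistrib matrix_scaleR_right)
  also have "\<dots> = (2 * cos \<phi> * sin (real m * \<phi>) - sin ((real m - 1) * \<phi>)) *\<^sub>R C
      - sin (real m * \<phi>) *\<^sub>R mat 1"
    unfolding C by (simp add: algebra_simps)
  also have "2 * cos \<phi> * sin (real m * \<phi>) - sin ((real m - 1) * \<phi>) = sin (real (Suc m) * \<phi>)"
    using sin_add[of "real m * \<phi>" \<phi>] sin_diff[of "real m * \<phi>" \<phi>] by (simp add: algebra_simps)
  finally show ?case by simp
qed

text \<open>The numbers \<open>f\<close> and \<open>g\<close> are the coefficients in
  \<open>commutator_identity\<close>; the last hypothesis makes the image \<open>V\<close> of
  \<open>v\<close> commute with \<open>J\<close>.\<close>

lemma rho_tilde_kernel_half: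
  fixes k z :: real
  defines "f \<equiv> z\<^sup>2 * (2 - k) * (k - 1) + (k ^ 3 - k\<^sup>2 - 2 * k + 1)"
    and "g \<equiv> z\<^sup>2 * (2 - k) + (k\<^sup>2 - k - 1)"
  assumes z: "z > 2" and k: "k = x\<^sup>2 + y\<^sup>2 + z\<^sup>2 - x * y * z - 2" and \<phi>: "k = 2 * cos \<phi>" "sin \<phi> > 0"
    and m: "sin (real m * \<phi>) * f = sin ((real m - 1) * \<phi>) * g"
  shows "rho_tilde (x, y, z) (word_val F2 (case_gen F2_X F2_Y) (kernel_half m @ rev (kernel_half m))) = mat 1"
proof -
  let ?f = "gen_matrix (x, y, z)" and ?v = "kernel_half m"
  have cl: "?f g \<in> carrier SL2R" for g
    using gen_matrix_closed z by simp
  define t t' where "t = zeta z" and "t' = inverse t"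
  have t: "t * t' = 1" "z = t + t'"
    using zeta[of z] z by (auto simp: t_def t'_def)
  have X: "letter_val SL2R ?f (gX, True) = mat2 x (- 1) 1 0"
    and Y: "letter_val SL2R ?f (gY, True) = mat2 0 t' (- t) y"
    by (simp_all add: t_def t'_def)
  have X': "letter_val SL2R ?f (gX, False) = mat2 0 1 (- 1) x"
    using inv_SL2R_mat2[of x 0 "- 1" 1] by simp
  have Y': "letter_val SL2R ?f (gY, False) = mat2 y (- t') t 0"
    using inv_SL2R_mat2[of 0 y t' "- t"] t(1) by (simp add: t_def t'_def mult.commute)
  \<comment> \<open>The off-diagonal entries of the images of \<open>XY\<close> and
    \<open>YX\<close>, which are triangular in this normalisation.\<close>
  define \<beta> \<gamma> where "\<beta> = x * t' - y" and "\<gamma> = y - t * x"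
  define a a' b b' where "a = mat2 t \<beta> 0 t'" and "a' = mat2 t' (- \<beta>) 0 t"
    and "b = mat2 t' 0 \<gamma> t" and "b' = mat2 t 0 (- \<gamma>) t'"
  note ab_defs = a_def a'_def b_def b'_def
  have k': "k = z\<^sup>2 - 2 - \<beta> * \<gamma>"
    unfolding k \<beta>_def \<gamma>_def using t by algebra
  have xy: "mat2 x (- 1) 1 0 ** mat2 0 t' (- t) y = a" "mat2 0 t' (- t) y ** mat2 x (- 1) 1 0 = b"
      "mat2 0 1 (- 1) x ** mat2 y (- t') t 0 = b'" "mat2 y (- t') t 0 ** mat2 0 1 (- 1) x = a'"
    by (simp_all add: ab_defs \<beta>_def \<gamma>_def mat2_mult mat2_eq_iff mult.commute)
  define J where "J = a - b"
  note J_simps = J_def ab_defs \<beta>_def \<gamma>_def mat2_mult mat2_diff mat2_eq_iff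
  have JX: "mat2 x (- 1) 1 0 ** J ** mat2 x (- 1) 1 0 = J"
    unfolding J_simps by (intro conjI; algebra)
  have JX': "mat2 0 1 (- 1) x ** J ** mat2 0 1 (- 1) x = J"
    unfolding J_simps by (intro conjI; algebra)
  have JY: "mat2 0 t' (- t) y ** J ** mat2 0 t' (- t) y = J"
    unfolding J_simps using t(1) by (intro conjI; algebra)
  have JY': "mat2 y (- t') t 0 ** J ** mat2 y (- t') t 0 = J"
    unfolding J_simps using t(1) by (intro conjI; algebra)
  have J: "letter_val SL2R ?f l ** J ** letter_val SL2R ?f l = J" for l
  proof -
    obtain s e where "l = (s, e)" by (cases l)
    then show ?thesis by (cases s; cases e) (simp_all only: X X' Y Y' JX JX' JY JY')
  qed
  define V where "V = word_val SL2R ?f ?v"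
  have C: "word_val SL2R ?f [(gX, False), (gY, False), (gX, True), (gY, True)] = b' ** a"
    by (simp only: word_val_Cons word_val_Nil X X' Y Y') (simp add: matrix_mul_assoc flip: xy)
  \<comment> \<open>Cayley-Hamilton for determinant 1 and trace \<open>k\<close>.\<close>
  have C2: "(b' ** a) ** (b' ** a) = (2 * cos \<phi>) *\<^sub>R (b' ** a) - mat 1"
    unfolding \<phi>(1)[symmetric] ab_defs mat2_mult mat2_one mat2_diff mat2_scaleR mat2_eq_iff k'
    using t by (intro conjI; algebra)
  have "V = b ** a' ** word_val SL2R ?f (concat (replicate m [(gX, False), (gY, False), (gX, True), (gY, True)]))
      ** b' ** (a' ** b)"
    unfolding V_def kernel_half_def group.word_val_append[OF group_SL2R, of ?f, OF cl] word_val_Cons word_val_Nil X X' Y Y'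
    by (simp add: matrix_mul_assoc flip: xy)
  then have "sin \<phi> *\<^sub>R V = b ** a' ** (sin (real m * \<phi>) *\<^sub>R (b' ** a) - sin ((real m - 1) * \<phi>) *\<^sub>R mat 1)
      ** b' ** (a' ** b)"
    unfolding cayley_hamilton_power[OF C2 cl C, symmetric]
    by (simp add: matrix_scaleR_right matrix_scaleR_left)
  also have "\<dots> = sin (real m * \<phi>) *\<^sub>R (b ** a' ** (b' ** a) ** b' ** (a' ** b))
      - sin ((real m - 1) * \<phi>) *\<^sub>R (b ** a' ** b' ** (a' ** b))" (is "_ = _ *\<^sub>R ?P - _ *\<^sub>R ?Q")
    by (simp add: matrix_diff_ldistrib matrix_diff_rdistrib matrix_scaleR_right matrix_scaleR_left)
  finally have V: "sin \<phi> *\<^sub>R V = sin (real m * \<phi>) *\<^sub>R ?P - sin ((real m - 1) * \<phi>) *\<^sub>R ?Q" .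
  have PQ: "?P ** J - J ** ?P = f *\<^sub>R (a ** b - b ** a)" "?Q ** J - J ** ?Q = g *\<^sub>R (a ** b - b ** a)"
    using commutator_identity[OF t k'] unfolding J_def f_def g_def ab_defs by blast+
  have "sin \<phi> *\<^sub>R (V ** J - J ** V) = (sin \<phi> *\<^sub>R V) ** J - J ** (sin \<phi> *\<^sub>R V)"
    by (simp add: matrix_scaleR_right matrix_scaleR_left algebra_simps)
  also have "\<dots> = sin (real m * \<phi>) *\<^sub>R (?P ** J - J ** ?P) - sin ((real m - 1) * \<phi>) *\<^sub>R (?Q ** J - J ** ?Q)"
    unfolding V
    by (simp add: matrix_diff_ldistrib matrix_diff_rdistrib matrix_scaleR_right matrix_scaleR_left algebra_simps)
  also have "\<dots> = 0"
    unfolding PQ using m by simp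
  finally have VJ: "V ** J = J ** V"
    using \<phi>(2) by simp
  \<comment> \<open>The determinant of \<open>J\<close> is \<open>2 - k\<close>, so
    \<open>k < 2\<close> allows \<open>J\<close> to be cancelled once it has been moved to the left
    of \<open>V\<close>.\<close>
  have "(cos \<phi>)\<^sup>2 < 1"
    using \<phi>(2) sin_cos_squared_add[of \<phi>] zero_less_power[of "sin \<phi>" 2] by linarith
  then have "k < 2"
    using abs_square_less_1[of "cos \<phi>"] by (simp add: \<phi>(1))
  moreover have "det J = 2 - k"
    unfolding J_def ab_defs mat2_diff k' using t by (simp add: det_2) algebra
  ultimately obtain J' where J': "J' ** J = mat 1"
    using invertible_det_nz[of J] invertible_left_inverse[of J] by auto
  have "J' ** (V ** J ** word_val SL2R ?f (rev ?v)) = J' ** J"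
    using word_val_rev_hyperelliptic[OF cl J] unfolding V_def by simp
  then have "V ** word_val SL2R ?f (rev ?v) = mat 1"
    unfolding VJ by (simp add: matrix_mul_assoc J')
  then show ?thesis
    unfolding rho_tilde_def group.word_val_word_val_F2[OF group_SL2R, of ?f, OF cl] group.word_val_append[OF group_SL2R, of ?f, OF cl] V_def
    by simp
qed

section \<open>Density of the solutions\<close>

text \<open>The cotangent has period \<open>pi\<close> and takes every real value on
  \<open>(0, pi)\<close>, while the positive multiples of \<open>\<phi>\<close> are dense modulo
  \<open>pi\<close> by Kronecker's theorem.\<close>

lemma dense_cot_multiples:
  fixes \<phi> u v :: real
  assumes "\<phi> / pi \<notin> \<rat>" and "u < v"
  obtains m :: nat where "sin (real m * \<phi>) \<noteq> 0" "u < cot (real m * \<phi>)" "cot (real m * \<phi>) < v"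
proof -
  \<comment> \<open>The arccotangent of the midpoint of the target interval.\<close>
  define \<alpha> where "\<alpha> = pi / 2 - arctan ((u + v) / 2)"
  have \<alpha>: "0 < \<alpha>" "\<alpha> < pi"
    using arctan_bounded[of "(u + v) / 2"] by (auto simp: \<alpha>_def)
  have "cot \<alpha> = (u + v) / 2"
    unfolding \<alpha>_def using tan_cot'[of "pi / 2 - arctan ((u + v) / 2)"] by (simp add: tan_arctan)
  moreover have "sin \<alpha> \<noteq> 0"
    using sin_gt_zero[OF \<alpha>] by simp
  then have "isCont cot \<alpha>" by (rule isCont_cot)
  ultimately have "\<forall>\<^sub>F x in nhds \<alpha>. cot x \<in> {u<..<v}"
    using assms(2) by (intro topological_tendstoD[where f = cot])  (auto simp: isCont_def tendsto_at_iff_tendsto_nhds)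
  moreover have "\<forall>\<^sub>F x in nhds \<alpha>. sin x \<noteq> 0"
    using \<open>sin \<alpha> \<noteq> 0\<close> by (intro tendsto_imp_eventually_ne[where f = sin]) (auto intro!: tendsto_intros filterlim_ident)
  ultimately have "\<forall>\<^sub>F x in nhds \<alpha>. sin x \<noteq> 0 \<and> u < cot x \<and> cot x < v"
    by eventually_elim auto
  then obtain d where "d > 0" and d: "\<And>x. \<bar>x - \<alpha>\<bar> < d \<Longrightarrow> sin x \<noteq> 0 \<and> u < cot x \<and> cot x < v"
    by (auto simp: eventually_nhds_metric dist_real_def)
  from \<open>d > 0\<close> have "d / pi > 0" by simp
  then obtain h m :: int where m: "m > 0" and "\<bar>of_int m * (\<phi> / pi) - of_int h - \<alpha> / pi\<bar> < d / pi"
    using sequence_of_fractional_parts_is_dense[OF assms(1)] by metis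
  then have "pi * \<bar>of_int m * (\<phi> / pi) - of_int h - \<alpha> / pi\<bar> < d"
    by (simp add: field_simps)
  moreover have "of_int m * \<phi> - of_int h * pi - \<alpha> = pi * (of_int m * (\<phi> / pi) - of_int h - \<alpha> / pi)"
    by (simp add: field_simps)
  ultimately have "\<bar>(of_int m * \<phi> - of_int h * pi) - \<alpha>\<bar> < d"
    by (simp add: abs_mult)
  then have *: "sin (of_int m * \<phi> - of_int h * pi) \<noteq> 0 \<and> u < cot (of_int m * \<phi> - of_int h * pi)
      \<and> cot (of_int m * \<phi> - of_int h * pi) < v"
    by (rule d)
  \<comment> \<open>A shift by \<open>h * pi\<close> multiplies sine and cosine by the same nonzero
    factor, so the cotangent is unchanged.\<close>
  have si: "sin (of_int h * pi) = 0" using sin_integer_2pi sin_zero_iff_int2 by blast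
  then have co: "cos (of_int h * pi) \<noteq> 0"
    by (metis sin_cos_squared_add zero_neq_one power_zero_numeral add_0)
  have "sin (of_int m * \<phi> - of_int h * pi) = sin (of_int m * \<phi>) * cos (of_int h * pi)"
    "cos (of_int m * \<phi> - of_int h * pi) = cos (of_int m * \<phi>) * cos (of_int h * pi)"
    by (simp_all add: sin_diff cos_diff si)
  with * co have "sin (of_int m * \<phi>) \<noteq> 0 \<and> u < cot (of_int m * \<phi>) \<and> cot (of_int m * \<phi>) < v"
    by (simp add: cot_def)
  with m show thesis by (intro that[of "nat m"]) auto
qed

text \<open>The factor of \<open>sin (m * \<phi>)\<close> equals
  \<open>(k - 1) * g s - k * (2 - k)\<close>. Expanding \<open>sin ((m - 1) * \<phi>)\<close> and
  dividing by \<open>sin (m * \<phi>) * sin \<phi> * g s\<close> gives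
  \<open>cot (m * \<phi>) = F s\<close>, which the intermediate value theorem solves.\<close>

lemma kernel_parameters_dense:
  fixes \<phi> k s\<^sub>1 s\<^sub>2 :: real
  assumes \<phi>: "sin \<phi> > 0" "\<phi> / pi \<notin> \<rat>" "k = 2 * cos \<phi>" and k: "k \<noteq> 0" "k < 2" and s: "2 < s\<^sub>1" "s\<^sub>1 < s\<^sub>2"
  obtains s and m :: nat where "s\<^sub>1 \<le> s" "s \<le> s\<^sub>2"
    "sin (real m * \<phi>) * (s\<^sup>2 * (2 - k) * (k - 1) + (k ^ 3 - k\<^sup>2 - 2 * k + 1))
     = sin ((real m - 1) * \<phi>) * (s\<^sup>2 * (2 - k) + (k\<^sup>2 - k - 1))"
proof -
  define g where "g s = s\<^sup>2 * (2 - k) + (k\<^sup>2 - k - 1)" for s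
  define F where "F s = (1 - k / 2 + k * (2 - k) / g s) / sin \<phi>" for s
  have g: "g s > 0" if "s > 2" for s
  proof -
    \<comment> \<open>As \<open>k < 2\<close>, \<open>g s\<close> is at least its value at
      \<open>s = 2\<close>, a quadratic in \<open>k\<close> without real roots.\<close>
    have "4 * (2 - k) \<le> s\<^sup>2 * (2 - k)"
      using that k power_mono[of 2 s 2] by (intro mult_right_mono) auto
    moreover have "4 * (2 - k) + (k\<^sup>2 - k - 1) = (k - 5 / 2)\<^sup>2 + 3 / 4"
      by (simp add: power2_eq_square algebra_simps)
    moreover have "(k - 5 / 2)\<^sup>2 \<ge> 0" by simp
    ultimately show ?thesis unfolding g_def by linarith
  qed
  have cont: "continuous_on {s\<^sub>1..s\<^sub>2} F"
  proof -
    have "continuous_on {s\<^sub>1..s\<^sub>2} g"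
      unfolding g_def by (intro continuous_intros)
    moreover have "\<forall>s\<in>{s\<^sub>1..s\<^sub>2}. g s \<noteq> 0"
      using g s by (metis atLeastAtMost_iff less_irrefl less_le_trans)
    ultimately show ?thesis
      unfolding F_def using \<phi>(1) by (intro continuous_intros) auto
  qed
  \<comment> \<open>Only the term \<open>k * (2 - k) / g s\<close> of \<open>F s\<close> varies; its
    numerator is nonzero and \<open>g\<close> is injective on positive \<open>s\<close>.\<close>
  have "F s\<^sub>1 \<noteq> F s\<^sub>2"
  proof
    assume "F s\<^sub>1 = F s\<^sub>2"
    then have "g s\<^sub>1 = g s\<^sub>2"
      using g[of s\<^sub>1] g[of s\<^sub>2] s \<phi> k by (simp add: F_def field_simps)
    then have "s\<^sub>1\<^sup>2 = s\<^sub>2\<^sup>2" using k by (simp add: g_def)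
    then show False using s by (simp add: power2_eq_iff)
  qed
  then have "min (F s\<^sub>1) (F s\<^sub>2) < max (F s\<^sub>1) (F s\<^sub>2)" by auto
  then obtain m :: nat where m: "sin (real m * \<phi>) \<noteq> 0"
    "min (F s\<^sub>1) (F s\<^sub>2) < cot (real m * \<phi>)" "cot (real m * \<phi>) < max (F s\<^sub>1) (F s\<^sub>2)"
    using dense_cot_multiples[OF \<phi>(2)] by metis
  have "\<exists>s. s\<^sub>1 \<le> s \<and> s \<le> s\<^sub>2 \<and> F s = cot (real m * \<phi>)"
  proof (cases "F s\<^sub>1 \<le> F s\<^sub>2")
    case True
    with m s show ?thesis by (intro IVT' cont) auto
  next
    case False
    with m s show ?thesis by (intro IVT2' cont) auto
  qed
  then obtain s where s': "s\<^sub>1 \<le> s" "s \<le> s\<^sub>2" and F: "F s = cot (real m * \<phi>)" by blast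
  have gs: "g s > 0" using s s' by (intro g) auto
  have "cos (real m * \<phi>) * sin \<phi> * g s = sin (real m * \<phi>) * ((1 - k / 2) * g s + k * (2 - k))"
    using F m(1) gs \<phi>(1) by (simp add: F_def cot_def field_simps)
  moreover have "sin ((real m - 1) * \<phi>) = sin (real m * \<phi>) * (k / 2) - cos (real m * \<phi>) * sin \<phi>"
    using sin_diff[of "real m * \<phi>" \<phi>] by (simp add: \<phi>(3) algebra_simps)
  ultimately have "sin ((real m - 1) * \<phi>) * g s =
      sin (real m * \<phi>) * (k / 2) * g s - sin (real m * \<phi>) * ((1 - k / 2) * g s + k * (2 - k))"
    by (simp add: left_diff_distrib)
  also have "\<dots> = sin (real m * \<phi>) * ((k - 1) * g s - k * (2 - k))"
    by (simp add: field_simps)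
  also have "(k - 1) * g s - k * (2 - k) = s\<^sup>2 * (2 - k) * (k - 1) + (k ^ 3 - k\<^sup>2 - 2 * k + 1)"
    by (simp add: g_def power2_eq_square power3_eq_cube algebra_simps)
  finally show thesis using s' by (intro that[of s m]) (simp_all add: g_def)
qed

section \<open>The dense set of parameters for a given cone angle\<close>

theorem theorem5p3:
  fixes \<theta> :: real
  assumes "0 < \<theta>" and "\<theta> < 2 * pi" and "\<theta> \<notin> {q * pi | q. q \<in> \<rat>}"
  shows "\<exists>S. S \<subseteq> {2<..} \<and> {2<..} \<subseteq> closure S \<and>
    (\<forall>s\<in>S. \<forall>\<xi>\<in>fricke_klein \<theta> \<inter> {(x, y, z). z = s}.
      \<exists>w\<in>kernel F2 PSL2R (rho \<xi>). palindromic w \<and> non_torsion_type w)"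
proof -
  \<comment> \<open>With this \<open>\<phi>\<close>, \<open>k = - 2 * cos (\<theta> / 2)\<close>,
    the commutator trace prescribed by the Fricke-Klein equation.\<close>
  define \<phi> k where "\<phi> = pi - \<theta> / 2" and "k = 2 * cos \<phi>"
  have \<phi>: "0 < \<phi>" "\<phi> < pi" using assms by (auto simp: \<phi>_def)
  then have sin: "sin \<phi> > 0" by (rule sin_gt_zero)
  have irr: "\<phi> / pi \<notin> \<rat>"
  proof
    assume "\<phi> / pi \<in> \<rat>"
    then have "2 * (1 - \<phi> / pi) \<in> \<rat>" by (intro Rats_mult Rats_diff) auto
    moreover have "\<theta> = 2 * (1 - \<phi> / pi) * pi" by (simp add: \<phi>_def field_simps)
    ultimately show False using assms(3) by blast
  qed
  \<comment> \<open>For \<open>k = 0\<close> the function \<open>F\<close> above would be constant;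
    irrationality excludes this right angle.\<close>
  have "k \<noteq> 0"
  proof
    assume "k = 0"
    then have "\<phi> = pi / 2"
      using \<phi> cos_inj_pi[of \<phi> "pi / 2"] by (simp add: k_def)
    with irr show False by simp
  qed
  have "k < 2"
    using \<phi> cos_monotone_0_pi[of 0 \<phi>] by (simp add: k_def)
  \<comment> \<open>The equation involves \<open>s\<close> and \<open>m\<close> but neither
    \<open>x\<close> nor \<open>y\<close>, so one word serves the whole coordinate curve.\<close>
  define S where "S = {s. s > 2 \<and> (\<exists>m :: nat.
      sin (real m * \<phi>) * (s\<^sup>2 * (2 - k) * (k - 1) + (k ^ 3 - k\<^sup>2 - 2 * k + 1))
      = sin ((real m - 1) * \<phi>) * (s\<^sup>2 * (2 - k) + (k\<^sup>2 - k - 1)))}"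
  show ?thesis
  proof (intro exI[of _ S] conjI ballI)
    show "S \<subseteq> {2<..}" by (auto simp: S_def)
    show "{2<..} \<subseteq> closure S"
    proof (clarsimp simp: closure_approachable)
      fix s\<^sub>0 e :: real assume *: "2 < s\<^sub>0" "0 < e"
      \<comment> \<open>Searching to the right of \<open>s\<^sub>0\<close> keeps
        \<open>s > 2\<close>; halving \<open>e\<close> makes the distance bound strict.\<close>
      obtain s and m :: nat where "s\<^sub>0 \<le> s" "s \<le> s\<^sub>0 + e / 2"
        "sin (real m * \<phi>) * (s\<^sup>2 * (2 - k) * (k - 1) + (k ^ 3 - k\<^sup>2 - 2 * k + 1))
         = sin ((real m - 1) * \<phi>) * (s\<^sup>2 * (2 - k) + (k\<^sup>2 - k - 1))"
        by (rule kernel_parameters_dense[OF sin irr k_def \<open>k \<noteq> 0\<close> \<open>k < 2\<close> *(1), of "s\<^sub>0 + e / 2"])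
          (use * in auto)
      with * show "\<exists>s\<in>S. dist s s\<^sub>0 < e"
        by (intro bexI[of _ s]) (auto simp: S_def dist_real_def)
    qed
    fix s \<xi> assume "s \<in> S" and "\<xi> \<in> fricke_klein \<theta> \<inter> {(x, y, z). z = s}"
    then obtain m where "s > 2" and m:
      "sin (real m * \<phi>) * (s\<^sup>2 * (2 - k) * (k - 1) + (k ^ 3 - k\<^sup>2 - 2 * k + 1))
      = sin ((real m - 1) * \<phi>) * (s\<^sup>2 * (2 - k) + (k\<^sup>2 - k - 1))"
      unfolding S_def by blast
    have "k = - 2 * cos (\<theta> / 2)" by (simp add: k_def \<phi>_def cos_diff)
    with \<open>\<xi> \<in> _\<close> obtain x y where \<xi>: "\<xi> = (x, y, s)" and "k = x\<^sup>2 + y\<^sup>2 + s\<^sup>2 - x * y * s - 2"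
      by (auto simp: fricke_klein_def)
    from rho_tilde_kernel_half[OF \<open>s > 2\<close> this(2) k_def sin m]
    have "rho_tilde \<xi> (word_val F2 (case_gen F2_X F2_Y) (kernel_half m @ rev (kernel_half m))) = mat 1"
      (is "rho_tilde \<xi> ?w = _")
      unfolding \<xi> .
    \<comment> \<open>The identity of the quotient is the coset
      \<open>{mat 1, - mat 1}\<close>.\<close>
    then have "rho \<xi> ?w = \<one>\<^bsub>PSL2R\<^esub>"
      by (simp add: rho_def PSL2R_proj_def PSL2R_def FactGroup_def r_coset_def insert_commute)
    then have "?w \<in> kernel F2 PSL2R (rho \<xi>)"
      by (simp add: kernel_def word_val_F2_closed)
    then show "\<exists>w\<in>kernel F2 PSL2R (rho \<xi>). palindromic w \<and> non_torsion_type w"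
      using palindromic_append_rev non_torsion_type_kernel_half by blast
  qed
qed

end
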